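(* Let $(A,[-,-]_A,\Delta_r)$ be a factorizable Leibniz bialgebra and let $\lambda\in\mathbb{K}$, $\lambda\neq0$. Let $\omega$ be the bilinear form on $A$ given by \[ \omega(x,y)=-\lambda\langle T_{r-\sigma(r)}^{-1}(x),y\rangle,\qquad\forall x,y\in A, \] and let $\beta:A\to A$ be the linear map given by $\beta(x)=T_r\omega^\sharp(x)$ for all $x\in A$. Then $(A,[-,-]_A,\omega,\beta)$ is a skew-symmetric quadratic Rota-Baxter Leibniz algebra of weight $\lambda$.
   Context: All vector spaces and algebras are finite-dimensional over an algebraically closed field $\mathbb{K}$ of characteristic zero. A (left) Leibniz algebra is a vector space $A$ with a bilinear multiplication $[-,-]_A$ satisfying $[x,[y,z]_A]_A=[[x,y]_A,z]_A+[y,[x,z]_A]_A$. Define $\mathcal{L}_A(x)y=[x,y]_A=\mathcal{R}_A(y)x$, $\sigma(x\otimes y)=y\otimes x$, and $F(x)=(\mathcal{L}_A+\mathcal{R}_A)(x)\otimes\mathrm{id}-\mathrm{id}\otimes\mathcal{R}_A(x)\in\mathrm{End}(A\otimes A)$. For $r=\sum_i a_i\otimes b_i\in A\otimes A$ put $[[r,r]]=\sum_{i,j}\big([a_i,a_j]_A\otimes b_i\otimes b_j-a_i\otimes([b_i,a_j]_A+[a_j,b_i]_A)\otimes b_j+a_i\otimes a_j\otimes[b_j,b_i]_A\big)$; $r$ is a solution of the classical Leibniz Yang-Baxter equation (CLYBE) if $[[r,r]]=0$. If $r$ is a solution of the CLYBE and $F(x)(r-\sigma(r))=0$ for all $x\in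 A$, then $(A,[-,-]_A,\Delta_r)$ with $\Delta_r(x)=F(x)r$ (which is then a Leibniz bialgebra) is called quasi-triangular; it is factorizable if moreover $T_{r-\sigma(r)}:A^*\to A$ is a linear isomorphism, where for $s\in A\otimes A$ the map $T_s:A^*\to A$ is given by $\langle T_s(a^* ),b^*\rangle=\langle s,a^*\otimes b^*\rangle$. For a nondegenerate bilinear form $\omega$ on $A$, $\omega^\sharp:A\to A^*$ is given by $\omega(x,y)=\langle\omega^\sharp(x),y\rangle$. A skew-symmetric quadratic Leibniz algebra $(A,[-,-]_A,\omega)$ is a Leibniz algebra with a nondegenerate skew-symmetric bilinear form $\omega$ such that $\omega(x,[y,z]_A)=\omega([x,z]_A+[z,x]_A,y)$ for all $x,y,z\in A$. A Rota-Baxter operator of weight $\lambda$ on $(A,[-,-]_A)$ is a linear map $\beta:A\to A$ with $[\beta(x),\beta(y)]_A=\beta([x,\beta(y)]_A+[\beta(x),y]_A+\lambda[x,y]_A)$. A skew-symmetric quadratic Rota-Baxter Leibniz algebra of weight $\lambda$ is a quadruple $(A,[-,-]_A,\omega,\beta)$ with $(A,[-,-]_A,\omega)$ a skew-symmetric quadratic Leibniz algebra and $\beta$ a Rota-Baxter operator of weight $\lambda$ on $(A,[-,-]_A)$ such that $\omega(\beta(x),y)+\omega(x,\beta(y))+\lambda\omega(x,y)=0$ for all $x,y\in A$. *)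

theory Defs
  imports
    "HOL-Computational_Algebra.Computational_Algebra"
    "HOL-Library.Function_Algebras"
begin

section \<open>Finite-dimensional spaces, duals and bilinear maps\<close>

text \<open>A vector space is given by its scalar multiplication \<open>s\<close> on an abelian group type, as
  in the library locale \<^locale>\<open>vector_space\<close>. Vectors in the dual space are plain
  functions into the field, with pointwise operations.\<close>

definition fin_dim_vector_space :: "('k::field \<Rightarrow> 'a::ab_group_add \<Rightarrow> 'a) \<Rightarrow> bool" where
  "fin_dim_vector_space s \<longleftrightarrow> (\<exists>B. finite_dimensional_vector_space s B)"

definition dual :: "('k::field \<Rightarrow> 'a::ab_group_add \<Rightarrow> 'a) \<Rightarrow> ('a \<Rightarrow> 'k) set" where
  "dual s = {f. Vector_Spaces.linear s (*) f}"

definition bilinear_map ::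
  "('k::field \<Rightarrow> 'a::ab_group_add \<Rightarrow> 'a) \<Rightarrow> ('k \<Rightarrow> 'b::ab_group_add \<Rightarrow> 'b) \<Rightarrow>
   ('k \<Rightarrow> 'c::ab_group_add \<Rightarrow> 'c) \<Rightarrow> ('a \<Rightarrow> 'b \<Rightarrow> 'c) \<Rightarrow> bool" where
  "bilinear_map s1 s2 s3 B \<longleftrightarrow>
     (\<forall>x. Vector_Spaces.linear s2 s3 (\<lambda>y. B x y)) \<and>
     (\<forall>y. Vector_Spaces.linear s1 s3 (\<lambda>x. B x y))"


section \<open>Tensors\<close>

text \<open>The tensor \<open>a \<otimes> b\<close> is realised as the function \<open>(f, g) \<mapsto> f a * g b\<close> on pairs of linear
  functionals (and \<open>0\<close> elsewhere, so that equality of tensors is equality of functions), and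
  \<open>A \<otimes> A\<close> as the set of finite sums of such functions. Lemma \<open>tensor_lift_sum\<close> below is the
  universal property of this model: every bilinear map on \<open>A \<times> A\<close> factors through it. Triple
  tensors are treated in the same way.\<close>

type_synonym ('k, 'a) tensor2 = "('a \<Rightarrow> 'k) \<Rightarrow> ('a \<Rightarrow> 'k) \<Rightarrow> 'k"
type_synonym ('k, 'a) tensor3 = "('a \<Rightarrow> 'k) \<Rightarrow> ('a \<Rightarrow> 'k) \<Rightarrow> ('a \<Rightarrow> 'k) \<Rightarrow> 'k"

definition tensor :: "('k::field \<Rightarrow> 'a::ab_group_add \<Rightarrow> 'a) \<Rightarrow> 'a \<Rightarrow> 'a \<Rightarrow> ('k, 'a) tensor2" where
  "tensor s a b = (\<lambda>f g. if f \<in> dual s \<and> g \<in> dual s then f a * g b else 0)"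

definition tensor_triple ::
  "('k::field \<Rightarrow> 'a::ab_group_add \<Rightarrow> 'a) \<Rightarrow> 'a \<Rightarrow> 'a \<Rightarrow> 'a \<Rightarrow> ('k, 'a) tensor3" where
  "tensor_triple s a b c =
     (\<lambda>f g h. if f \<in> dual s \<and> g \<in> dual s \<and> h \<in> dual s then f a * g b * h c else 0)"

definition tensor_sum ::
  "('k::field \<Rightarrow> 'a::ab_group_add \<Rightarrow> 'a) \<Rightarrow> ('a \<times> 'a) list \<Rightarrow> ('k, 'a) tensor2" where
  "tensor_sum s xs = (\<Sum>(a, b)\<leftarrow>xs. tensor s a b)"

definition tensor_space :: "('k::field \<Rightarrow> 'a::ab_group_add \<Rightarrow> 'a) \<Rightarrow> ('k, 'a) tensor2 set" where
  "tensor_space s = range (tensor_sum s)"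

text \<open>The map on \<open>A \<otimes> A\<close> induced by a bilinear map \<open>B\<close>, i.e. the one sending
  \<open>\<Sum>i. a\<^sub>i \<otimes> b\<^sub>i\<close> to \<open>\<Sum>i. B a\<^sub>i b\<^sub>i\<close>; by \<open>tensor_lift_sum\<close> the choice of the
  representation is immaterial.\<close>

definition tensor_lift ::
  "('k::field \<Rightarrow> 'a::ab_group_add \<Rightarrow> 'a) \<Rightarrow> ('a \<Rightarrow> 'a \<Rightarrow> 'c::ab_group_add) \<Rightarrow>
   ('k, 'a) tensor2 \<Rightarrow> 'c" where
  "tensor_lift s B t = (\<Sum>(a, b)\<leftarrow>(SOME xs. t = tensor_sum s xs). B a b)"

text \<open>\<open>\<sigma>\<close>, \<open>\<phi> \<otimes> \<psi>\<close> and \<open>\<langle>t, f \<otimes> g\<rangle>\<close>\<close>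

definition tensor_flip ::
  "('k::field \<Rightarrow> 'a::ab_group_add \<Rightarrow> 'a) \<Rightarrow> ('k, 'a) tensor2 \<Rightarrow> ('k, 'a) tensor2" where
  "tensor_flip s = tensor_lift s (\<lambda>a b. tensor s b a)"

definition tensor_map ::
  "('k::field \<Rightarrow> 'a::ab_group_add \<Rightarrow> 'a) \<Rightarrow> ('a \<Rightarrow> 'a) \<Rightarrow> ('a \<Rightarrow> 'a) \<Rightarrow>
   ('k, 'a) tensor2 \<Rightarrow> ('k, 'a) tensor2" where
  "tensor_map s \<phi> \<psi> = tensor_lift s (\<lambda>a b. tensor s (\<phi> a) (\<psi> b))"

definition tensor_pairing ::
  "('k::field \<Rightarrow> 'a::ab_group_add \<Rightarrow> 'a) \<Rightarrow> ('k, 'a) tensor2 \<Rightarrow> ('a \<Rightarrow> 'k) \<Rightarrow> ('a \<Rightarrow> 'k) \<Rightarrow> 'k" where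
  "tensor_pairing s t f g = tensor_lift s (\<lambda>a b. f a * g b) t"

text \<open>\<open>T\<^sub>t : A\<^sup>* \<rightarrow> A\<close>. Elements of \<open>A\<close> are determined by the values of linear functionals on
  them; see \<open>tensor_op_sum\<close> for existence.\<close>

definition tensor_op ::
  "('k::field \<Rightarrow> 'a::ab_group_add \<Rightarrow> 'a) \<Rightarrow> ('k, 'a) tensor2 \<Rightarrow> ('a \<Rightarrow> 'k) \<Rightarrow> 'a" where
  "tensor_op s t f = (THE y. \<forall>g\<in>dual s. g y = tensor_pairing s t f g)"

definition dual_linear_iso ::
  "('k::field \<Rightarrow> 'a::ab_group_add \<Rightarrow> 'a) \<Rightarrow> (('a \<Rightarrow> 'k) \<Rightarrow> 'a) \<Rightarrow> bool" where
  "dual_linear_iso s T \<longleftrightarrow>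
     (\<forall>f\<in>dual s. \<forall>g\<in>dual s. T (\<lambda>x. f x + g x) = T f + T g) \<and>
     (\<forall>c. \<forall>f\<in>dual s. T (\<lambda>x. c * f x) = s c (T f)) \<and>
     bij_betw T (dual s) UNIV"


section \<open>Leibniz algebras and factorizable Leibniz bialgebras\<close>

definition leibniz_algebra ::
  "('k::field \<Rightarrow> 'a::ab_group_add \<Rightarrow> 'a) \<Rightarrow> ('a \<Rightarrow> 'a \<Rightarrow> 'a) \<Rightarrow> bool" where
  "leibniz_algebra s br \<longleftrightarrow>
     fin_dim_vector_space s \<and> bilinear_map s s s br \<and>
     (\<forall>x y z. br x (br y z) = br (br x y) z + br y (br x z))"

definition left_mult :: "('a \<Rightarrow> 'a \<Rightarrow> 'a) \<Rightarrow> 'a \<Rightarrow> 'a \<Rightarrow> 'a" where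
  "left_mult br x y = br x y"

definition right_mult :: "('a \<Rightarrow> 'a \<Rightarrow> 'a) \<Rightarrow> 'a \<Rightarrow> 'a \<Rightarrow> 'a" where
  "right_mult br x y = br y x"

definition F_op ::
  "('k::field \<Rightarrow> 'a::ab_group_add \<Rightarrow> 'a) \<Rightarrow> ('a \<Rightarrow> 'a \<Rightarrow> 'a) \<Rightarrow> 'a \<Rightarrow>
   ('k, 'a) tensor2 \<Rightarrow> ('k, 'a) tensor2" where
  "F_op s br x t =
     tensor_map s (\<lambda>y. left_mult br x y + right_mult br x y) id t
     - tensor_map s id (right_mult br x) t"

text \<open>\<open>[[r, r]]\<close>, where \<open>(a, b)\<close> runs through the pairs \<open>(a\<^sub>i, b\<^sub>i)\<close> and \<open>(a', b')\<close> through the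
  pairs \<open>(a\<^sub>j, b\<^sub>j)\<close> of a representation of \<open>r\<close>; see \<open>YB_bracket_sum\<close>.\<close>

definition YB_bracket ::
  "('k::field \<Rightarrow> 'a::ab_group_add \<Rightarrow> 'a) \<Rightarrow> ('a \<Rightarrow> 'a \<Rightarrow> 'a) \<Rightarrow>
   ('k, 'a) tensor2 \<Rightarrow> ('k, 'a) tensor3" where
  "YB_bracket s br r =
     tensor_lift s (\<lambda>a b. tensor_lift s (\<lambda>a' b'.
         tensor_triple s (br a a') b b'
       - tensor_triple s a (br b a' + br a' b) b'
       + tensor_triple s a a' (br b' b)) r) r"

definition CLYBE_solution ::
  "('k::field \<Rightarrow> 'a::ab_group_add \<Rightarrow> 'a) \<Rightarrow> ('a \<Rightarrow> 'a \<Rightarrow> 'a) \<Rightarrow> ('k, 'a) tensor2 \<Rightarrow> bool" where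
  "CLYBE_solution s br r \<longleftrightarrow> r \<in> tensor_space s \<and> YB_bracket s br r = 0"

definition coboundary ::
  "('k::field \<Rightarrow> 'a::ab_group_add \<Rightarrow> 'a) \<Rightarrow> ('a \<Rightarrow> 'a \<Rightarrow> 'a) \<Rightarrow> ('k, 'a) tensor2 \<Rightarrow>
   'a \<Rightarrow> ('k, 'a) tensor2" where
  "coboundary s br r x = F_op s br x r"

definition quasi_triangular_leibniz_bialgebra ::
  "('k::field \<Rightarrow> 'a::ab_group_add \<Rightarrow> 'a) \<Rightarrow> ('a \<Rightarrow> 'a \<Rightarrow> 'a) \<Rightarrow> ('a \<Rightarrow> ('k, 'a) tensor2) \<Rightarrow>
   ('k, 'a) tensor2 \<Rightarrow> bool" where
  "quasi_triangular_leibniz_bialgebra s br D r \<longleftrightarrow>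
     leibniz_algebra s br \<and> D = coboundary s br r \<and> CLYBE_solution s br r \<and>
     (\<forall>x. F_op s br x (r - tensor_flip s r) = 0)"

definition factorizable_leibniz_bialgebra ::
  "('k::field \<Rightarrow> 'a::ab_group_add \<Rightarrow> 'a) \<Rightarrow> ('a \<Rightarrow> 'a \<Rightarrow> 'a) \<Rightarrow> ('a \<Rightarrow> ('k, 'a) tensor2) \<Rightarrow>
   ('k, 'a) tensor2 \<Rightarrow> bool" where
  "factorizable_leibniz_bialgebra s br D r \<longleftrightarrow>
     quasi_triangular_leibniz_bialgebra s br D r \<and>
     dual_linear_iso s (tensor_op s (r - tensor_flip s r))"


section \<open>Skew-symmetric quadratic Rota-Baxter Leibniz algebras\<close>

definition sharp :: "('a \<Rightarrow> 'a \<Rightarrow> 'k) \<Rightarrow> 'a \<Rightarrow> ('a \<Rightarrow> 'k)" where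
  "sharp \<omega> x = (\<lambda>y. \<omega> x y)"

definition nondegenerate :: "('a::zero \<Rightarrow> 'a \<Rightarrow> 'k::zero) \<Rightarrow> bool" where
  "nondegenerate \<omega> \<longleftrightarrow>
     (\<forall>x. (\<forall>y. \<omega> x y = 0) \<longrightarrow> x = 0) \<and> (\<forall>y. (\<forall>x. \<omega> x y = 0) \<longrightarrow> y = 0)"

definition skew_quadratic_leibniz_algebra ::
  "('k::field \<Rightarrow> 'a::ab_group_add \<Rightarrow> 'a) \<Rightarrow> ('a \<Rightarrow> 'a \<Rightarrow> 'a) \<Rightarrow> ('a \<Rightarrow> 'a \<Rightarrow> 'k) \<Rightarrow> bool" where
  "skew_quadratic_leibniz_algebra s br \<omega> \<longleftrightarrow>
     leibniz_algebra s br \<and> bilinear_map s s (*) \<omega> \<and> nondegenerate \<omega> \<and>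
     (\<forall>x y. \<omega> x y = - \<omega> y x) \<and>
     (\<forall>x y z. \<omega> x (br y z) = \<omega> (br x z + br z x) y)"

definition rota_baxter_operator ::
  "('k::field \<Rightarrow> 'a::ab_group_add \<Rightarrow> 'a) \<Rightarrow> ('a \<Rightarrow> 'a \<Rightarrow> 'a) \<Rightarrow> 'k \<Rightarrow> ('a \<Rightarrow> 'a) \<Rightarrow> bool" where
  "rota_baxter_operator s br l \<beta> \<longleftrightarrow>
     Vector_Spaces.linear s s \<beta> \<and>
     (\<forall>x y. br (\<beta> x) (\<beta> y) = \<beta> (br x (\<beta> y) + br (\<beta> x) y + s l (br x y)))"

definition skew_quadratic_rota_baxter_leibniz_algebra ::
  "('k::field \<Rightarrow> 'a::ab_group_add \<Rightarrow> 'a) \<Rightarrow> ('a \<Rightarrow> 'a \<Rightarrow> 'a) \<Rightarrow> ('a \<Rightarrow> 'a \<Rightarrow> 'k) \<Rightarrow>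
   ('a \<Rightarrow> 'a) \<Rightarrow> 'k \<Rightarrow> bool" where
  "skew_quadratic_rota_baxter_leibniz_algebra s br \<omega> \<beta> l \<longleftrightarrow>
     skew_quadratic_leibniz_algebra s br \<omega> \<and> rota_baxter_operator s br l \<beta> \<and>
     (\<forall>x y. \<omega> (\<beta> x) y + \<omega> x (\<beta> y) + l * \<omega> x y = 0)"


section \<open>Well-definedness\<close>

lemma tensor_sum_apply:
  "tensor_sum s xs f g =
     (if f \<in> dual s \<and> g \<in> dual s then (\<Sum>(a, b)\<leftarrow>xs. f a * g b) else 0)"
  by (induction xs) (auto simp: tensor_sum_def tensor_def)

lemma bilinear_map_coordinates:
  assumes fd: "finite_dimensional_vector_space s Bs" and B: "bilinear_map s s s3 B"
  shows "B a b = (\<Sum>u\<in>Bs. \<Sum>v\<in>Bs.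
    s3 (module.representation s Bs a u * module.representation s Bs b v) (B u v))"
proof -
  interpret V: finite_dimensional_vector_space s Bs by (rule fd)
  let ?R = "V.representation Bs"
  have l1: "Vector_Spaces.linear s s3 (\<lambda>x. B x y)" and l2: "Vector_Spaces.linear s s3 (B x)" for x y
    using B by (auto simp: bilinear_map_def)
  interpret W: vector_space s3
    using l1 unfolding Vector_Spaces.linear_def by blast
  have e: "(\<Sum>u\<in>Bs. s (?R x u) u) = x" for x
    by (rule V.sum_representation_eq) (auto simp: V.independent_Basis V.finite_Basis V.span_Basis)
  have "B a b = B (\<Sum>u\<in>Bs. s (?R a u) u) b" by (simp only: e)
  also have "\<dots> = (\<Sum>u\<in>Bs. s3 (?R a u) (B u b))"
    by (simp add: module_hom.sum[OF Vector_Spaces.linear.axioms(3)[OF l1]] module_hom.scale[OF Vector_Spaces.linear.axioms(3)[OF l1]])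
  also have "\<dots> = (\<Sum>u\<in>Bs. s3 (?R a u) (\<Sum>v\<in>Bs. s3 (?R b v) (B u v)))"
  proof (rule sum.cong[OF refl])
    fix u
    have "B u b = B u (\<Sum>v\<in>Bs. s (?R b v) v)" by (simp only: e)
    also have "\<dots> = (\<Sum>v\<in>Bs. s3 (?R b v) (B u v))"
      by (simp add: module_hom.sum[OF Vector_Spaces.linear.axioms(3)[OF l2]] module_hom.scale[OF Vector_Spaces.linear.axioms(3)[OF l2]])
    finally show "s3 (?R a u) (B u b) = s3 (?R a u) (\<Sum>v\<in>Bs. s3 (?R b v) (B u v))" by simp
  qed
  finally show ?thesis by (simp add: W.scale_sum_right)
qed

lemma representation_dual:
  assumes fd: "finite_dimensional_vector_space s Bs"
  shows "(\<lambda>a. module.representation s Bs a u) \<in> dual s"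
proof -
  interpret V: finite_dimensional_vector_space s Bs by (rule fd)
  interpret K: vector_space "(*) :: 'a \<Rightarrow> 'a \<Rightarrow> 'a"
    by unfold_locales (auto simp: algebra_simps)
  show ?thesis unfolding dual_def mem_Collect_eq
    by unfold_locales
      (auto simp: V.representation_add V.representation_scale V.independent_Basis V.span_Basis)
qed

lemma tensor_lift_sum:
  assumes fd: "fin_dim_vector_space s" and B: "bilinear_map s s s3 B"
  shows "tensor_lift s B (tensor_sum s xs) = (\<Sum>(a, b)\<leftarrow>xs. B a b)"
proof -
  obtain Bs where Bs: "finite_dimensional_vector_space s Bs"
    using fd by (auto simp: fin_dim_vector_space_def)
  have "Vector_Spaces.linear s s3 (B x)" for x using B by (auto simp: bilinear_map_def)
  then interpret W: vector_space s3
    unfolding Vector_Spaces.linear_def by blast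
  let ?R = "\<lambda>u a. module.representation s Bs a u"
  have R: "?R u \<in> dual s" for u by (rule representation_dual[OF Bs])
  have key: "(\<Sum>(a, b)\<leftarrow>ys. B a b) =
    (\<Sum>u\<in>Bs. \<Sum>v\<in>Bs. s3 (tensor_sum s ys (?R u) (?R v)) (B u v))" for ys
  proof (induction ys)
    case Nil
    then show ?case by (simp add: tensor_sum_apply R)
  next
    case (Cons p ys)
    obtain a b where p: "p = (a, b)" by force
    show ?case
      using Cons bilinear_map_coordinates[OF Bs B, of a b]
      by (simp add: p tensor_sum_apply R W.scale_left_distrib sum.distrib)
  qed
  have "tensor_sum s xs = tensor_sum s (SOME ys. tensor_sum s xs = tensor_sum s ys)"
    by (rule someI[of "\<lambda>ys. tensor_sum s xs = tensor_sum s ys" xs]) simp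
  then show ?thesis unfolding tensor_lift_def key by simp
qed

lemma dual_iff:
  fixes s :: "'k::field \<Rightarrow> 'a::ab_group_add \<Rightarrow> 'a"
  assumes "vector_space s"
  shows "f \<in> dual s \<longleftrightarrow> (\<forall>x y. f (x + y) = f x + f y) \<and> (\<forall>c x. f (s c x) = c * f x)"
proof -
  interpret V: vector_space s by fact
  interpret K: vector_space "(*) :: 'k \<Rightarrow> 'k \<Rightarrow> 'k"
    by unfold_locales (auto simp: algebra_simps)
  show ?thesis unfolding dual_def mem_Collect_eq
    by (auto intro!: Vector_Spaces.linear.intro module_hom.intro module_hom_axioms.intro
        V.vector_space_axioms K.vector_space_axioms V.module_axioms K.module_axioms
        dest: module_hom.add[OF Vector_Spaces.linear.axioms(3)] module_hom.scale[OF Vector_Spaces.linear.axioms(3)])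
qed

lemma bilinear_map_iff:
  assumes "vector_space s" "vector_space s3"
  shows "bilinear_map s s s3 B \<longleftrightarrow>
    (\<forall>x y z. B (x + y) z = B x z + B y z) \<and> (\<forall>x y z. B x (y + z) = B x y + B x z) \<and>
    (\<forall>c x y. B (s c x) y = s3 c (B x y)) \<and> (\<forall>c x y. B x (s c y) = s3 c (B x y))"
proof -
  interpret V: vector_space s by fact
  interpret W: vector_space s3 by fact
  have "Vector_Spaces.linear s s3 h \<longleftrightarrow>
      (\<forall>x y. h (x + y) = h x + h y) \<and> (\<forall>c x. h (s c x) = s3 c (h x))" for h
    by (auto intro!: Vector_Spaces.linear.intro module_hom.intro module_hom_axioms.intro
        V.vector_space_axioms W.vector_space_axioms V.module_axioms W.module_axioms
        dest: module_hom.add[OF Vector_Spaces.linear.axioms(3)] module_hom.scale[OF Vector_Spaces.linear.axioms(3)])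
  then show ?thesis unfolding bilinear_map_def by auto
qed

lemma fin_dim_vector_space_imp: "fin_dim_vector_space s \<Longrightarrow> vector_space s"
  by (auto simp: fin_dim_vector_space_def finite_dimensional_vector_space_def)

lemma vector_space_field: "vector_space ((*) :: 'k::field \<Rightarrow> 'k \<Rightarrow> 'k)"
  by unfold_locales (auto simp: algebra_simps)

lemma vector_space_tensor2: "vector_space (\<lambda>c (t :: ('k::field, 'a) tensor2) f g. c * t f g)"
  by unfold_locales (auto simp: algebra_simps fun_eq_iff)

lemma vector_space_tensor3: "vector_space (\<lambda>c (t :: ('k::field, 'a) tensor3) f g h. c * t f g h)"
  by unfold_locales (auto simp: algebra_simps fun_eq_iff)

lemma tensor_flip_sum:
  assumes fd: "fin_dim_vector_space s"
  shows "tensor_flip s (tensor_sum s xs) = (\<Sum>(a, b)\<leftarrow>xs. tensor s b a)"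
proof -
  note V = fin_dim_vector_space_imp[OF fd]
  show ?thesis unfolding tensor_flip_def
    by (rule tensor_lift_sum[OF fd, where ?s3.0 = "\<lambda>c t f g. c * t f g"])
      (auto simp: bilinear_map_iff[OF V vector_space_tensor2] tensor_def fun_eq_iff
        dual_iff[OF V] algebra_simps)
qed

lemma tensor_map_sum:
  assumes fd: "fin_dim_vector_space s"
    and "Vector_Spaces.linear s s \<phi>" "Vector_Spaces.linear s s \<psi>"
  shows "tensor_map s \<phi> \<psi> (tensor_sum s xs) = (\<Sum>(a, b)\<leftarrow>xs. tensor s (\<phi> a) (\<psi> b))"
proof -
  note V = fin_dim_vector_space_imp[OF fd]
  note l = assms(2,3)[THEN Vector_Spaces.linear.axioms(3)]
  show ?thesis unfolding tensor_map_def
    by (rule tensor_lift_sum[OF fd, where ?s3.0 = "\<lambda>c t f g. c * t f g"])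
      (auto simp: bilinear_map_iff[OF V vector_space_tensor2] tensor_def fun_eq_iff
        dual_iff[OF V] algebra_simps l[THEN module_hom.add] l[THEN module_hom.scale])
qed

lemma tensor_pairing_sum:
  assumes fd: "fin_dim_vector_space s" and "f \<in> dual s" "g \<in> dual s"
  shows "tensor_pairing s (tensor_sum s xs) f g = (\<Sum>(a, b)\<leftarrow>xs. f a * g b)"
proof -
  note V = fin_dim_vector_space_imp[OF fd]
  show ?thesis unfolding tensor_pairing_def
    using assms(2,3)
    by (intro tensor_lift_sum[OF fd, where ?s3.0 = "(*)"])
      (auto simp: bilinear_map_iff[OF V vector_space_field] dual_iff[OF V] algebra_simps)
qed

lemma tensor_op_sum:
  assumes fd: "fin_dim_vector_space s" and f: "f \<in> dual s"
  shows "tensor_op s (tensor_sum s xs) f = (\<Sum>(a, b)\<leftarrow>xs. s (f a) b)"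
  unfolding tensor_op_def
proof (rule the_equality)
  note V = fin_dim_vector_space_imp[OF fd]
  have ev: "g (\<Sum>(a, b)\<leftarrow>xs. s (f a) b) = (\<Sum>(a, b)\<leftarrow>xs. f a * g b)" if g: "g \<in> dual s" for g
  proof -
    from g have "g 0 = 0"
      unfolding dual_iff[OF V] by (metis add_cancel_right_right)
    with g show ?thesis by (induction xs) (auto simp: dual_iff[OF V])
  qed
  then show "\<forall>g\<in>dual s. g (\<Sum>(a, b)\<leftarrow>xs. s (f a) b) = tensor_pairing s (tensor_sum s xs) f g"
    by (simp add: tensor_pairing_sum[OF fd f])
  fix y assume y: "\<forall>g\<in>dual s. g y = tensor_pairing s (tensor_sum s xs) f g"
  obtain Bs where Bs: "finite_dimensional_vector_space s Bs"
    using fd by (auto simp: fin_dim_vector_space_def)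
  interpret V: finite_dimensional_vector_space s Bs by (rule Bs)
  have e: "(\<Sum>u\<in>Bs. s (V.representation Bs x u) u) = x" for x
    by (rule V.sum_representation_eq) (auto simp: V.independent_Basis V.finite_Basis V.span_Basis)
  have "V.representation Bs y u = V.representation Bs (\<Sum>(a, b)\<leftarrow>xs. s (f a) b) u" for u
    using y ev[OF representation_dual[OF Bs]] representation_dual[OF Bs, of u]
    by (simp add: tensor_pairing_sum[OF fd f])
  then have "V.representation Bs y = V.representation Bs (\<Sum>(a, b)\<leftarrow>xs. s (f a) b)"
    by (rule ext)
  then show "y = (\<Sum>(a, b)\<leftarrow>xs. s (f a) b)"
    by (metis e)
qed

lemma YB_bracket_sum:
  assumes "leibniz_algebra s br"
  shows "YB_bracket s br (tensor_sum s xs) =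
    (\<Sum>(a, b)\<leftarrow>xs. \<Sum>(a', b')\<leftarrow>xs.
         tensor_triple s (br a a') b b'
       - tensor_triple s a (br b a' + br a' b) b'
       + tensor_triple s a a' (br b' b))"
proof -
  have fd: "fin_dim_vector_space s" and br: "bilinear_map s s s br"
    using assms by (auto simp: leibniz_algebra_def)
  note V = fin_dim_vector_space_imp[OF fd]
  let ?s3 = "\<lambda>c (t :: ('a, 'b) tensor3) f g h. c * t f g h"
  define X where "X a b a' b' = tensor_triple s (br a a') b b'
       - tensor_triple s a (br b a' + br a' b) b' + tensor_triple s a a' (br b' b)" for a b a' b'
  note B = br[unfolded bilinear_map_iff[OF V V]]
  have add: "tensor_triple s (a + a') b c = tensor_triple s a b c + tensor_triple s a' b c"
    "tensor_triple s a (b + b') c = tensor_triple s a b c + tensor_triple s a b' c"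
    "tensor_triple s a b (c + c') = tensor_triple s a b c + tensor_triple s a b c'"
    for a a' b b' c c'
    by (auto simp: tensor_triple_def fun_eq_iff dual_iff[OF V] algebra_simps)
  have scale: "tensor_triple s (s k a) b c = ?s3 k (tensor_triple s a b c)"
    "tensor_triple s a (s k b) c = ?s3 k (tensor_triple s a b c)"
    "tensor_triple s a b (s k c) = ?s3 k (tensor_triple s a b c)" for k a b c
    by (auto simp: tensor_triple_def fun_eq_iff dual_iff[OF V] algebra_simps)
  have B1: "br (x + y) z = br x z + br y z" "br x (y + z) = br x y + br x z"
    "br (s c x) y = s c (br x y)" "br x (s c y) = s c (br x y)" for c x y z
    using B by auto
  have V_add: "s c (x + y) = s c x + s c y" for c x y
    using V by (simp add: vector_space_def)
  have X_add: "X (a + x) b a' b' = X a b a' b' + X x b a' b'"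
    "X a (b + x) a' b' = X a b a' b' + X a x a' b'"
    "X a b (a' + x) b' = X a b a' b' + X a b x b'"
    "X a b a' (b' + x) = X a b a' b' + X a b a' x" for a b a' b' x
    by (simp_all add: X_def B1 add)
  have X_scale: "X (s c a) b a' b' = ?s3 c (X a b a' b')"
    "X a (s c b) a' b' = ?s3 c (X a b a' b')"
    "X a b (s c a') b' = ?s3 c (X a b a' b')"
    "X a b a' (s c b') = ?s3 c (X a b a' b')" for a b a' b' c
    by (simp_all add: X_def B1 V_add[symmetric] scale)
      (simp_all add: fun_eq_iff right_diff_distrib distrib_left)
  have "bilinear_map s s ?s3 (X a b)" for a b
    unfolding bilinear_map_iff[OF V vector_space_tensor3] by (simp add: X_add X_scale)
  then have inner: "tensor_lift s (X a b) (tensor_sum s xs) = (\<Sum>(a', b')\<leftarrow>xs. X a b a' b')" for a b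
    by (rule tensor_lift_sum[OF fd])
  have inner_add: "(\<Sum>(a', b')\<leftarrow>xs. X (a + x) b a' b') =
      (\<Sum>(a', b')\<leftarrow>xs. X a b a' b') + (\<Sum>(a', b')\<leftarrow>xs. X x b a' b')"
    "(\<Sum>(a', b')\<leftarrow>xs. X a (b + x) a' b') =
      (\<Sum>(a', b')\<leftarrow>xs. X a b a' b') + (\<Sum>(a', b')\<leftarrow>xs. X a x a' b')" for a b x
    by (simp_all add: X_add case_prod_unfold sum_list_addf)
  have inner_scale: "(\<Sum>(a', b')\<leftarrow>xs. X (s c a) b a' b') = ?s3 c (\<Sum>(a', b')\<leftarrow>xs. X a b a' b')"
    "(\<Sum>(a', b')\<leftarrow>xs. X a (s c b) a' b') = ?s3 c (\<Sum>(a', b')\<leftarrow>xs. X a b a' b')" for a b c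
    by (induction xs) (auto simp: X_scale fun_eq_iff distrib_left)
  have "bilinear_map s s ?s3 (\<lambda>a b. \<Sum>(a', b')\<leftarrow>xs. X a b a' b')"
    unfolding bilinear_map_iff[OF V vector_space_tensor3] by (simp add: inner_add inner_scale)
  then have "tensor_lift s (\<lambda>a b. tensor_lift s (X a b) (tensor_sum s xs)) (tensor_sum s xs) =
      (\<Sum>(a, b)\<leftarrow>xs. \<Sum>(a', b')\<leftarrow>xs. X a b a' b')"
    unfolding inner by (rule tensor_lift_sum[OF fd])
  then show ?thesis
    unfolding YB_bracket_def X_def .
qed

end

theory Submission
  imports Defs
begin

text \<open>Put \<open>S = T\<^bsub>r-\<sigma>(r)\<^esub>\<close>, \<open>T = T\<^sub>r\<close> and \<open>P = S\<^sup>-\<^sup>1\<close>. Evaluated on functionals, the invariance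
  \<open>F(x)(r - \<sigma>(r)) = 0\<close> says \<open>[S f, x] = S (f \<circ> (L + R)(x))\<close>, which is the invariance of \<open>\<omega>\<close>; since
  \<open>\<omega>\<close> is skew it also gives \<open>[x, S g] = - S (g \<circ> L(x))\<close>. The CLYBE says
  \<open>[T f, T g] = T (f \<circ> (L + R)(T g)) - T (g \<circ> L(T f - S f))\<close>. As \<open>\<beta> (S f) = - \<lambda> T f\<close>, substituting the
  two formulas for brackets with \<open>S\<close> into the CLYBE turns it into the Rota-Baxter identity.\<close>

section \<open>Finite sums under linear and bilinear maps\<close>

lemma sum_list_swap:
  fixes h :: "'a \<Rightarrow> 'b \<Rightarrow> 'c::comm_monoid_add"
  shows "(\<Sum>x\<leftarrow>xs. \<Sum>y\<leftarrow>ys. h x y) = (\<Sum>y\<leftarrow>ys. \<Sum>x\<leftarrow>xs. h x y)"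
  by (induction xs) (simp_all add: sum_list_addf)

lemma sum_list_apply: "(\<Sum>x\<leftarrow>xs. F x) y = (\<Sum>x\<leftarrow>xs. F x y)"
  by (induction xs) simp_all

lemma linear_map_iff:
  assumes "vector_space s" "vector_space s'"
  shows "Vector_Spaces.linear s s' f \<longleftrightarrow>
    (\<forall>x y. f (x + y) = f x + f y) \<and> (\<forall>c x. f (s c x) = s' c (f x))"
proof -
  interpret V: vector_space s by fact
  interpret W: vector_space s' by fact
  show ?thesis
    by (auto intro!: Vector_Spaces.linear.intro module_hom.intro module_hom_axioms.intro
        V.vector_space_axioms W.vector_space_axioms V.module_axioms W.module_axioms
        dest: module_hom.add[OF Vector_Spaces.linear.axioms(3)]
          module_hom.scale[OF Vector_Spaces.linear.axioms(3)])
qed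

lemma linear_sum_list:
  assumes "Vector_Spaces.linear s s' f"
  shows "f (\<Sum>x\<leftarrow>xs. F x) = (\<Sum>x\<leftarrow>xs. f (F x))"
proof -
  interpret Vector_Spaces.linear s s' f by fact
  show ?thesis by (induction xs) (simp_all add: zero add)
qed

lemma bilinear_map_sum_list:
  assumes "bilinear_map s1 s2 s3 B"
  shows "B (\<Sum>x\<leftarrow>xs. F x) (\<Sum>y\<leftarrow>ys. G y) = (\<Sum>x\<leftarrow>xs. \<Sum>y\<leftarrow>ys. B (F x) (G y))"
proof -
  have "Vector_Spaces.linear s2 s3 (B x)" "Vector_Spaces.linear s1 s3 (\<lambda>x. B x y)" for x y
    using assms by (auto simp: bilinear_map_def)
  note * = this[THEN linear_sum_list]
  show ?thesis unfolding *(2) unfolding *(1) ..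
qed

section \<open>Linear functionals\<close>

lemma dual_linear: "f \<in> dual s \<Longrightarrow> Vector_Spaces.linear s (*) f"
  by (simp add: dual_def)

lemma dual_add: "f \<in> dual s \<Longrightarrow> f (x + y) = f x + f y"
  by (rule module_hom.add[OF Vector_Spaces.linear.axioms(3)[OF dual_linear]])

lemma dual_scale: "f \<in> dual s \<Longrightarrow> f (s c x) = c * f x"
  by (rule module_hom.scale[OF Vector_Spaces.linear.axioms(3)[OF dual_linear]])

lemma dual_diff: "f \<in> dual s \<Longrightarrow> f (x - y) = f x - f y"
  by (rule module_hom.diff[OF Vector_Spaces.linear.axioms(3)[OF dual_linear]])

lemma dual_compose:
  assumes "f \<in> dual s" "Vector_Spaces.linear s s \<phi>"
  shows "(\<lambda>x. f (\<phi> x)) \<in> dual s"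
proof -
  note \<phi> = Vector_Spaces.linear.axioms(3)[OF assms(2)]
  have "vector_space s" using assms(2) by (simp add: Vector_Spaces.linear_def)
  then show ?thesis
    using assms(1) by (simp add: dual_iff module_hom.add[OF \<phi>] module_hom.scale[OF \<phi>])
qed

lemma dual_plus:
  assumes "vector_space s" "f \<in> dual s" "g \<in> dual s"
  shows "(\<lambda>x. f x + g x) \<in> dual s"
  using assms by (simp add: dual_iff algebra_simps)

lemma dual_mult:
  assumes "vector_space s" "f \<in> dual s"
  shows "(\<lambda>x. c * f x) \<in> dual s"
  using assms by (simp add: dual_iff algebra_simps)

lemma dual_minus:
  assumes "vector_space s" "f \<in> dual s" "g \<in> dual s"
  shows "(\<lambda>x. f x - g x) \<in> dual s"
  using assms by (simp add: dual_iff algebra_simps)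

text \<open>Coordinates with respect to a finite basis are themselves functionals. Every identity in
  the algebra below is reduced to one in the field this way.\<close>

lemma dual_separates:
  assumes fd: "fin_dim_vector_space s" and eq: "\<And>g. g \<in> dual s \<Longrightarrow> g x = g y"
  shows "x = y"
proof -
  obtain Bs where Bs: "finite_dimensional_vector_space s Bs"
    using fd by (auto simp: fin_dim_vector_space_def)
  interpret V: finite_dimensional_vector_space s Bs by (rule Bs)
  have e: "(\<Sum>u\<in>Bs. s (V.representation Bs x u) u) = x" for x
    by (rule V.sum_representation_eq) (auto simp: V.independent_Basis V.finite_Basis V.span_Basis)
  have "V.representation Bs x = V.representation Bs y"
    using eq[OF representation_dual[OF Bs]] by (intro ext)
  then show ?thesis by (metis e)
qed

section \<open>Tensors as bilinear forms on the dual space\<close>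

lemma tensor_spaceE:
  assumes "t \<in> tensor_space s"
  obtains xs where "t = tensor_sum s xs"
  using assms by (auto simp: tensor_space_def)

text \<open>No condition on \<open>h\<close> is called for: tensors vanish by convention off the
  dual space, so both sides are zero if \<open>h\<close> is not a functional.\<close>

lemma tensor_space_add_left:
  assumes "vector_space s" "t \<in> tensor_space s" "f \<in> dual s" "g \<in> dual s"
  shows "t (\<lambda>x. f x + g x) h = t f h + t g h"
  using assms(2-) dual_plus[OF assms(1,3,4)]
  by (auto simp: tensor_space_def tensor_sum_apply distrib_right case_prod_unfold sum_list_addf)

lemma tensor_space_mult_left:
  assumes "vector_space s" "t \<in> tensor_space s" "f \<in> dual s"
  shows "t (\<lambda>x. c * f x) h = c * t f h"
  using assms(2-) dual_mult[OF assms(1,3)]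
  by (auto simp: tensor_space_def tensor_sum_apply mult.assoc case_prod_unfold sum_list_const_mult)

lemma tensor_space_diff_left:
  assumes "vector_space s" "t \<in> tensor_space s" "f \<in> dual s" "g \<in> dual s"
  shows "t (\<lambda>x. f x - g x) h = t f h - t g h"
  using tensor_space_add_left[OF assms(1,2) dual_minus[OF assms(1,3,4)] assms(4)] by simp

lemma tensor_flip_apply:
  assumes "fin_dim_vector_space s" "t \<in> tensor_space s"
  shows "tensor_flip s t f g = t g f"
proof -
  obtain xs where t: "t = tensor_sum s xs" using assms(2) by (rule tensor_spaceE)
  show ?thesis
    unfolding t tensor_flip_sum[OF assms(1)] tensor_sum_apply
    by (induction xs) (auto simp: tensor_def mult.commute)
qed

lemma tensor_space_diff_flip:
  assumes "fin_dim_vector_space s" "t \<in> tensor_space s"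
  shows "t - tensor_flip s t \<in> tensor_space s"
proof -
  note V = fin_dim_vector_space_imp[OF assms(1)]
  obtain xs where t: "t = tensor_sum s xs" using assms(2) by (rule tensor_spaceE)
  \<comment> \<open>A list representing a tensor carries no coefficients, so the sign of each
    flipped term is absorbed into its left factor.\<close>
  have neg: "tensor s (s (-1) b) a = - tensor s b a" for a b
    by (auto simp: tensor_def fun_eq_iff dual_scale)
  have "t - tensor_flip s t = tensor_sum s (xs @ map (\<lambda>(a, b). (s (-1) b, a)) xs)"
    unfolding t tensor_flip_sum[OF assms(1)]
    by (simp add: tensor_sum_def case_prod_unfold comp_def neg
        uminus_sum_list_map[unfolded comp_def, symmetric])
  then show ?thesis by (simp add: tensor_space_def)
qed

lemma tensor_flip_in_tensor_space:
  assumes "fin_dim_vector_space s" "t \<in> tensor_space s"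
  shows "tensor_flip s t \<in> tensor_space s"
proof -
  obtain xs where t: "t = tensor_sum s xs" using assms(2) by (rule tensor_spaceE)
  have "tensor_flip s t = tensor_sum s (map (\<lambda>(a, b). (b, a)) xs)"
    unfolding t tensor_flip_sum[OF assms(1)]
    by (simp add: tensor_sum_def case_prod_unfold comp_def)
  then show ?thesis by (simp add: tensor_space_def)
qed

text \<open>On bilinear forms, a tensor product of maps acts by the transposed maps on the
  arguments.\<close>

lemma tensor_map_apply:
  assumes "fin_dim_vector_space s" "t \<in> tensor_space s"
    and lin: "Vector_Spaces.linear s s \<phi>" "Vector_Spaces.linear s s \<psi>"
    and fg: "f \<in> dual s" "g \<in> dual s"
  shows "tensor_map s \<phi> \<psi> t f g = t (\<lambda>x. f (\<phi> x)) (\<lambda>x. g (\<psi> x))"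
proof -
  obtain xs where t: "t = tensor_sum s xs" using assms(2) by (rule tensor_spaceE)
  have "(\<lambda>x. f (\<phi> x)) \<in> dual s" "(\<lambda>x. g (\<psi> x)) \<in> dual s"
    using fg lin by (blast intro: dual_compose)+
  with fg show ?thesis
    unfolding t tensor_map_sum[OF assms(1) lin] tensor_sum_apply
    by (induction xs) (auto simp: tensor_def)
qed

text \<open>The defining pairing of \<open>T_t\<close>, with \<open>tensor_op_sum\<close> supplying
  its existence. From here on, tensors can be evaluated without a chosen representation.\<close>

lemma dual_tensor_op:
  assumes "fin_dim_vector_space s" "t \<in> tensor_space s" "f \<in> dual s" "g \<in> dual s"
  shows "g (tensor_op s t f) = t f g"
proof -
  obtain xs where t: "t = tensor_sum s xs" using assms(2) by (rule tensor_spaceE)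
  show ?thesis
    using assms(3,4) unfolding t tensor_op_sum[OF assms(1,3)] tensor_sum_apply
    by (simp add: linear_sum_list[OF dual_linear] case_prod_unfold dual_scale)
qed

text \<open>Testing against functionals reduces this to linearity of the tensor in its left
  argument. It serves both \<open>r\<close> and \<open>r - \<sigma>(r)\<close>.\<close>

lemma tensor_op_linear:
  assumes fd: "fin_dim_vector_space s" and t: "t \<in> tensor_space s"
  shows "f \<in> dual s \<Longrightarrow> g \<in> dual s \<Longrightarrow>
      tensor_op s t (\<lambda>x. f x + g x) = tensor_op s t f + tensor_op s t g"
    and "f \<in> dual s \<Longrightarrow> tensor_op s t (\<lambda>x. c * f x) = s c (tensor_op s t f)"
proof -
  note V = fin_dim_vector_space_imp[OF fd]
  show "tensor_op s t (\<lambda>x. f x + g x) = tensor_op s t f + tensor_op s t g"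
    if "f \<in> dual s" "g \<in> dual s"
    using that by (intro dual_separates[OF fd])
      (simp add: dual_tensor_op[OF fd t] dual_add dual_plus[OF V] tensor_space_add_left[OF V t])
  show "tensor_op s t (\<lambda>x. c * f x) = s c (tensor_op s t f)" if "f \<in> dual s"
    using that by (intro dual_separates[OF fd])
      (simp add: dual_tensor_op[OF fd t] dual_scale dual_mult[OF V] tensor_space_mult_left[OF V t])
qed

lemma tensor_op_flip:
  assumes fd: "fin_dim_vector_space s" and t: "t \<in> tensor_space s" and f: "f \<in> dual s"
  shows "tensor_op s (tensor_flip s t) f = tensor_op s t f - tensor_op s (t - tensor_flip s t) f"
  using f by (intro dual_separates[OF fd])
    (simp add: dual_tensor_op[OF fd] t tensor_flip_in_tensor_space[OF fd t]
      tensor_space_diff_flip[OF fd t] dual_diff)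

section \<open>Invariance and the Yang-Baxter bracket evaluated on functionals\<close>

lemma F_op_apply:
  assumes lb: "leibniz_algebra s br" and t: "t \<in> tensor_space s"
    and f: "f \<in> dual s" and g: "g \<in> dual s"
  shows "F_op s br x t f g = t (\<lambda>y. f (br x y + br y x)) g - t f (\<lambda>y. g (br y x))"
proof -
  have fd: "fin_dim_vector_space s" and br: "bilinear_map s s s br"
    using lb by (auto simp: leibniz_algebra_def)
  note V = fin_dim_vector_space_imp[OF fd]
  have "Vector_Spaces.linear s s (\<lambda>y. left_mult br x y + right_mult br x y)"
    "Vector_Spaces.linear s s (right_mult br x)" "Vector_Spaces.linear s s id"
    using br V
    by (auto simp: linear_map_iff[OF V V] bilinear_map_iff[OF V V] left_mult_def right_mult_def
        vector_space_def algebra_simps)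
  then show ?thesis
    using f g by (simp add: F_op_def tensor_map_apply[OF fd t] left_mult_def right_mult_def)
qed

text \<open>In each term, one or two of the sums contract to a value of \<open>T\<close>: the sum of
  \<open>g(b_i) a_i\<close> is the flipped operator at \<open>g\<close>, the sum of
  \<open>f(a_i) b_i\<close> is \<open>T f\<close>, and the last term contracts twice.\<close>

lemma YB_bracket_apply:
  assumes lb: "leibniz_algebra s br" and t: "t \<in> tensor_space s"
    and f: "f \<in> dual s" and g: "g \<in> dual s" and h: "h \<in> dual s"
  shows "YB_bracket s br t f g h =
    t (\<lambda>x. f (br (tensor_op s (tensor_flip s t) g) x)) h
    - t (\<lambda>x. g (br (tensor_op s t f) x + br x (tensor_op s t f))) h
    + h (br (tensor_op s t g) (tensor_op s t f))"
proof -
  have fd: "fin_dim_vector_space s" and br: "bilinear_map s s s br"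
    using lb by (auto simp: leibniz_algebra_def)
  note V = fin_dim_vector_space_imp[OF fd]
  note brl = br[unfolded bilinear_map_iff[OF V V]]
  obtain xs where xs: "t = tensor_sum s xs" using t by (rule tensor_spaceE)
  have lin: "Vector_Spaces.linear s s (br u)" "Vector_Spaces.linear s s (\<lambda>x. br x u)" for u
    using br by (auto simp: bilinear_map_def)
  have lin2: "Vector_Spaces.linear s s (\<lambda>x. br u x + br x u)" for u
    using brl V by (auto simp: linear_map_iff[OF V V] vector_space_def)
  note [simp] = lin[THEN linear_sum_list]
  let ?L = "tensor_op s (tensor_flip s t) g" and ?T = "tensor_op s t"
  have T: "?T u = (\<Sum>p\<leftarrow>xs. s (u (fst p)) (snd p))" if "u \<in> dual s" for u
    using tensor_op_sum[OF fd that] by (simp add: xs case_prod_unfold)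
  have L: "?L = (\<Sum>p\<leftarrow>xs. s (g (snd p)) (fst p))"
  proof (rule dual_separates[OF fd])
    fix u assume u: "u \<in> dual s"
    then have "u ?L = t u g"
      using g by (simp add: dual_tensor_op[OF fd tensor_flip_in_tensor_space[OF fd t]]
          tensor_flip_apply[OF fd t])
    also have "\<dots> = u (\<Sum>p\<leftarrow>xs. s (g (snd p)) (fst p))"
      using u g by (simp add: xs tensor_sum_apply linear_sum_list[OF dual_linear] dual_scale
          case_prod_unfold mult.commute)
    finally show "u ?L = u (\<Sum>p\<leftarrow>xs. s (g (snd p)) (fst p))" .
  qed
  \<comment> \<open>Expanding the left side puts the sum of the tensor outside and the sum hidden in
    \<open>?L\<close> inside. The bracket has them the other way round, hence the swap, here and in
    the next two identities.\<close>
  have 1: "t (\<lambda>x. f (br ?L x)) h =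
      (\<Sum>p\<leftarrow>xs. \<Sum>q\<leftarrow>xs. f (br (fst p) (fst q)) * g (snd p) * h (snd q))"
    using h dual_compose[OF f lin(1)[of ?L]]
    by (subst sum_list_swap) (simp add: xs tensor_sum_apply case_prod_unfold L[unfolded xs] brl
        linear_sum_list[OF dual_linear[OF f]] dual_scale[OF f] sum_list_const_mult[symmetric] ac_simps)
  have 2: "t (\<lambda>x. g (br (?T f) x + br x (?T f))) h =
      (\<Sum>p\<leftarrow>xs. \<Sum>q\<leftarrow>xs. f (fst p) * g (br (snd p) (fst q) + br (fst q) (snd p)) * h (snd q))"
    using h dual_compose[OF g lin2[of "?T f"]]
    by (subst sum_list_swap) (simp add: xs tensor_sum_apply case_prod_unfold T[OF f, unfolded xs] brl
        linear_sum_list[OF dual_linear[OF g]] dual_scale[OF g] dual_add[OF g]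
        sum_list_const_mult[symmetric] sum_list_addf[symmetric] algebra_simps)
  have 3: "h (br (?T g) (?T f)) =
      (\<Sum>p\<leftarrow>xs. \<Sum>q\<leftarrow>xs. f (fst p) * g (fst q) * h (br (snd q) (snd p)))"
    by (subst sum_list_swap) (simp add: T f g bilinear_map_sum_list[OF br] brl
        linear_sum_list[OF dual_linear[OF h]] dual_scale[OF h] ac_simps
        del: lin[THEN linear_sum_list])
  have "YB_bracket s br t f g h = (\<Sum>p\<leftarrow>xs. \<Sum>q\<leftarrow>xs.
      f (br (fst p) (fst q)) * g (snd p) * h (snd q)
      - f (fst p) * g (br (snd p) (fst q) + br (fst q) (snd p)) * h (snd q)
      + f (fst p) * g (fst q) * h (br (snd q) (snd p)))"
    using f g h
    by (simp add: xs YB_bracket_sum[OF lb] case_prod_unfold sum_list_apply tensor_triple_def)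
  then show ?thesis
    unfolding 1 2 3 by (simp add: sum_list_addf sum_list_subtractf)
qed

theorem theorem4p22:
  fixes scale :: "'k::{alg_closed_field, field_char_0} \<Rightarrow> 'a::ab_group_add \<Rightarrow> 'a"
    and br :: "'a \<Rightarrow> 'a \<Rightarrow> 'a"
    and r :: "('k, 'a) tensor2"
    and l :: 'k
    and \<omega> :: "'a \<Rightarrow> 'a \<Rightarrow> 'k"
    and \<beta> :: "'a \<Rightarrow> 'a"
  assumes "factorizable_leibniz_bialgebra scale br (coboundary scale br r) r"
    and "l \<noteq> 0"
    and "\<And>x y. \<omega> x y =
      - l * inv_into (dual scale) (tensor_op scale (r - tensor_flip scale r)) x y"
    and "\<And>x. \<beta> x = tensor_op scale r (sharp \<omega> x)"
  shows "skew_quadratic_rota_baxter_leibniz_algebra scale br \<omega> \<beta> l"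
proof -
  define t where "t = r - tensor_flip scale r"
  define S where "S = tensor_op scale t"
  define P where "P = inv_into (dual scale) S"
  define T where "T = tensor_op scale r"
  have lb: "leibniz_algebra scale br" and r: "r \<in> tensor_space scale"
    and yb: "YB_bracket scale br r = 0" and inv: "\<And>x. F_op scale br x t = 0"
    and bij: "bij_betw S (dual scale) UNIV"
    using assms(1)
    by (auto simp: factorizable_leibniz_bialgebra_def quasi_triangular_leibniz_bialgebra_def
        CLYBE_solution_def dual_linear_iso_def t_def S_def)
  have fd: "fin_dim_vector_space scale" and br: "bilinear_map scale scale scale br"
    using lb by (auto simp: leibniz_algebra_def)
  note V = fin_dim_vector_space_imp[OF fd]
  note brl = br[unfolded bilinear_map_iff[OF V V]]
  have t: "t \<in> tensor_space scale"
    unfolding t_def by (rule tensor_space_diff_flip[OF fd r])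
  have lin: "Vector_Spaces.linear scale scale (br u)"
    "Vector_Spaces.linear scale scale (\<lambda>x. br x u)"
    "Vector_Spaces.linear scale scale (\<lambda>x. br u x + br x u)" for u
    using brl V by (auto simp: linear_map_iff[OF V V] vector_space_def)

  \<comment> \<open>The inverse \<open>P\<close> of \<open>S\<close>: linearity, skew-symmetry and
    invariance\<close>
  have P: "P x \<in> dual scale" and SP: "S (P x) = x" for x
    using bij_betwE[OF bij_betw_inv_into[OF bij]] bij_betw_inv_into_right[OF bij]
    by (auto simp: P_def)
  have PS: "P (S f) = f" if "f \<in> dual scale" for f
    using bij_betw_inv_into_left[OF bij that] by (simp add: P_def)
  have P_add: "P (x + y) = (\<lambda>v. P x v + P y v)" for x y
    using PS[OF dual_plus[OF V P[of x] P[of y]]]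
    by (simp add: S_def tensor_op_linear(1)[OF fd t P P] SP[unfolded S_def])
  have P_scale: "P (scale c x) = (\<lambda>v. c * P x v)" for c x
    using PS[OF dual_mult[OF V P[of x]]]
    by (simp add: S_def tensor_op_linear(2)[OF fd t P] SP[unfolded S_def])
  \<comment> \<open>\<open>t\<close> is antisymmetric as a difference of \<open>r\<close> and its
    flip, and its value at \<open>P y\<close>, \<open>P x\<close> is \<open>P x y\<close>.\<close>
  have P_skew: "P x y = - P y x" for x y
  proof -
    have "t (P y) (P x) = - t (P x) (P y)"
      by (simp add: t_def tensor_flip_apply[OF fd r])
    then have "P x (S (P y)) = - P y (S (P x))"
      by (simp add: S_def dual_tensor_op[OF fd t P P])
    then show ?thesis by (simp add: SP)
  qed
  \<comment> \<open>This is \<open>F(u) t = 0\<close> evaluated at \<open>P x\<close> and an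
    arbitrary \<open>g\<close>: one term is \<open>g (S ?f)\<close>, the other is
    \<open>g (br x u)\<close>.\<close>
  have P_right: "P (br x u) = (\<lambda>v. P x (br u v + br v u))" for x u
  proof -
    let ?f = "\<lambda>v. P x (br u v + br v u)"
    have f: "?f \<in> dual scale" by (rule dual_compose[OF P lin(3)])
    have "S ?f = br x u"
    proof (rule dual_separates[OF fd])
      fix g assume g: "g \<in> dual scale"
      have "g (S ?f) = t (P x) (\<lambda>y. g (br y u))"
        using F_op_apply[OF lb t P g, of u x] g f
        by (simp add: inv S_def dual_tensor_op[OF fd t])
      also have "\<dots> = g (br (S (P x)) u)"
        using dual_tensor_op[OF fd t P dual_compose[OF g lin(2)]] by (simp add: S_def)
      finally show "g (S ?f) = g (br x u)" by (simp add: SP)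
    qed
    with PS[OF f] show ?thesis by simp
  qed
  \<comment> \<open>After skew-symmetry both sides expand by \<open>P_right\<close> to
    \<open>P u\<close> at the same symmetrized bracket of \<open>y\<close> and
    \<open>v\<close>.\<close>
  have P_left: "P (br u y) v = - P y (br u v)" for u y v
    using P_skew[of y "br u v"] by (simp add: P_right add.commute)

  \<comment> \<open>The form \<open>\<omega>\<close> and its invariance\<close>
  have om: "\<omega> x y = - l * P x y" for x y
    using assms(3) by (simp add: P_def S_def t_def)
  have be: "\<beta> x = scale (- l) (T (P x))" for x
  proof -
    have "sharp \<omega> x = (\<lambda>y. - l * P x y)" by (simp add: sharp_def om)
    then show ?thesis
      by (simp only: assms(4) T_def tensor_op_linear(2)[OF fd r P])
  qed
  have "x = 0" if "\<And>y. P x y = 0" for x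
  proof -
    \<comment> \<open>Scaling by zero gives \<open>P 0 = 0\<close>; then \<open>S\<close> recovers
      \<open>x = 0\<close>. Nondegeneracy on the other side follows by skew-symmetry.\<close>
    have "P x = P 0"
      using that P_scale[of 0 0] V
      by (auto simp: module.scale_zero_right module_iff_vector_space fun_eq_iff)
    then show ?thesis by (metis SP)
  qed
  then have nondeg: "nondegenerate \<omega>"
    unfolding nondegenerate_def om
    using \<open>l \<noteq> 0\<close> P_skew by (metis minus_equation_iff mult_eq_0_iff neg_equal_0_iff_equal)
  have quad: "skew_quadratic_leibniz_algebra scale br \<omega>"
    unfolding skew_quadratic_leibniz_algebra_def
  proof (intro conjI allI lb nondeg)
    show "bilinear_map scale scale (*) \<omega>"
      by (simp add: bilinear_map_iff[OF V vector_space_field] om P_add P_scale dual_add[OF P]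
          dual_scale[OF P] algebra_simps)
    show "\<omega> x y = - \<omega> y x" for x y
      using P_skew[of x y] by (simp add: om)
    show "\<omega> x (br y z) = \<omega> (br x z + br z x) y" for x y z
      using P_skew[of x "br y z"] P_skew[of y] by (simp add: om P_right add.commute)
  qed

  \<comment> \<open>The Rota-Baxter identity\<close>
  have key: "br (T f) (T g) =
      T (\<lambda>v. f (br (T g) v + br v (T g)) - g (br (T f - S f) v))"
    if f: "f \<in> dual scale" and g: "g \<in> dual scale" for f g
  proof (rule dual_separates[OF fd])
    fix h assume h: "h \<in> dual scale"
    have d: "(\<lambda>v. f (br (T g) v + br v (T g))) \<in> dual scale"
      "(\<lambda>v. g (br (T f - S f) v)) \<in> dual scale"
      using dual_compose[OF f lin(3)] dual_compose[OF g lin(1)] .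
    have "h (T (\<lambda>v. f (br (T g) v + br v (T g)) - g (br (T f - S f) v))) =
        r (\<lambda>v. f (br (T g) v + br v (T g))) h - r (\<lambda>v. g (br (T f - S f) v)) h"
      using dual_tensor_op[OF fd r dual_minus[OF V d] h]
      by (simp only: T_def tensor_space_diff_left[OF V r d[unfolded T_def]])
    \<comment> \<open>The CLYBE is evaluated at \<open>g\<close>, \<open>f\<close>, \<open>h\<close>
      in this order, so that its last term is \<open>h (br (T f) (T g))\<close>. The flipped
      operator at \<open>f\<close> is \<open>T f - S f\<close>.\<close>
    also have "\<dots> = h (br (T f) (T g))"
      using YB_bracket_apply[OF lb r g f h]
      by (simp add: yb tensor_op_flip[OF fd r f] t_def[symmetric] S_def T_def algebra_simps)
    finally show "h (br (T f) (T g)) =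
        h (T (\<lambda>v. f (br (T g) v + br v (T g)) - g (br (T f - S f) v)))" ..
  qed
  have T_scale: "T (\<lambda>v. c * f v) = scale c (T f)" if "f \<in> dual scale" for c f
    unfolding T_def by (rule tensor_op_linear(2)[OF fd r that])
  have rb: "br (\<beta> x) (\<beta> y) = \<beta> (br x (\<beta> y) + br (\<beta> x) y + scale l (br x y))" for x y
  proof -
    let ?z = "br x (\<beta> y) + br (\<beta> x) y + scale l (br x y)"
    let ?k = "\<lambda>v. P x (br (T (P y)) v + br v (T (P y))) - P y (br (T (P x) - S (P x)) v)"
    have k: "?k \<in> dual scale"
      by (intro dual_minus[OF V] dual_compose[OF P] lin)
    have br_diff: "br (u - v) w = br u w - br v w" for u v w
      using brl by (metis add_diff_cancel diff_add_cancel)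
    \<comment> \<open>\<open>P_right\<close> handles \<open>br x (\<beta> y)\<close> and
      \<open>P_left\<close> the other two terms. The weight term, with \<open>x = S (P x)\<close>,
      supplies the summand with \<open>S\<close> in \<open>?k\<close>.\<close>
    have "P ?z = (\<lambda>v. - l * ?k v)"
      by (simp add: be brl P_add P_scale P_right[of x "T (P y)"] P_left[of _ y] SP br_diff dual_diff[OF P]
          algebra_simps fun_eq_iff)
    \<comment> \<open>One factor \<open>- l\<close> comes from \<open>P ?z\<close>, the other from
      \<open>\<beta>\<close>. They match the two factors in
      \<open>br (\<beta> x) (\<beta> y)\<close>, where \<open>key\<close> replaces
      \<open>T ?k\<close> by the bracket.\<close>
    then have "\<beta> ?z = scale (- l) (scale (- l) (T ?k))"
      unfolding be[of ?z] by (simp only: T_scale[OF k])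
    then show ?thesis
      unfolding key[OF P P, symmetric] by (simp add: be brl)
  qed
  show ?thesis
    unfolding skew_quadratic_rota_baxter_leibniz_algebra_def rota_baxter_operator_def
  proof (intro conjI allI quad rb)
    show "Vector_Spaces.linear scale scale \<beta>"
      using V by (auto simp: linear_map_iff[OF V V] be P_add P_scale T_scale[OF P]
          tensor_op_linear(1)[OF fd r P P, folded T_def] vector_space_def mult.commute)
    show "\<omega> (\<beta> x) y + \<omega> x (\<beta> y) + l * \<omega> x y = 0" for x y
    proof -
      \<comment> \<open>The compatibility of \<open>\<omega>\<close> and \<open>\<beta>\<close> is
        \<open>l * l\<close> times the equation \<open>t = r - \<sigma>(r)\<close> evaluated at
        \<open>P y\<close>, \<open>P x\<close>.\<close>
      have "P x y = P x (S (P y))" by (simp add: SP)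
      also have "\<dots> = t (P y) (P x)"
        by (simp add: S_def dual_tensor_op[OF fd t P P])
      also have "\<dots> = P x (T (P y)) - P y (T (P x))"
        by (simp add: T_def dual_tensor_op[OF fd r P P] t_def tensor_flip_apply[OF fd r])
      finally have "P x y = P x (T (P y)) - P y (T (P x))" .
      then show ?thesis
        by (simp add: om be P_scale dual_scale[OF P] P_skew[of "T (P x)" y] right_diff_distrib)
    qed
  qed
qed

end
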